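(* Let $(\mathfrak g,\mu,T,B)$ be a quadratic Hom-Lie algebra over $\mathbb F$ with $T$ in its centroid and $\dim\operatorname{Ker}(T)=r>0$, let $V$ be an $r$-dimensional vector space, and let $\mathfrak G=\mathfrak g\oplus V$, $B_{\mathfrak G}$, $\mu_{\mathfrak G}$, $L$ and the $2$-cocycle $\theta:\mathfrak g\times\mathfrak g\to V$ be as constructed in the context. Then: (i) If $B_{\mathfrak G}$ is invariant under $\mu_{\mathfrak G}$, i.e. $B_{\mathfrak G}(\mu_{\mathfrak G}(x,y),z)=B_{\mathfrak G}(x,\mu_{\mathfrak G}(y,z))$ for all $x,y,z\in\mathfrak G$, then $\theta=0$. (ii) $L$ is a centroid of $\mu_{\mathfrak G}$, i.e. $L(\mu_{\mathfrak G}(x,y))=\mu_{\mathfrak G}(L(x),y)$ for all $x,y\in\mathfrak G$, if and only if $\theta=0$.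
   Context: All vector spaces are finite dimensional over an algebraically closed field $\mathbb F$ of characteristic zero. A Hom-Lie algebra is a triple $(\mathfrak g,\mu,T)$ with $\mathfrak g$ a vector space, $\mu:\mathfrak g\times\mathfrak g\to\mathfrak g$ bilinear and skew-symmetric, and $T:\mathfrak g\to\mathfrak g$ linear, such that $\mu(T(x),\mu(y,z))+\mu(T(y),\mu(z,x))+\mu(T(z),\mu(x,y))=0$ for all $x,y,z\in\mathfrak g$. $T$ is in the centroid of $(\mathfrak g,\mu)$ if $T(\mu(x,y))=\mu(T(x),y)$ for all $x,y$. A quadratic Hom-Lie algebra $(\mathfrak g,\mu,T,B)$ is a Hom-Lie algebra with a symmetric non-degenerate bilinear form $B$ on $\mathfrak g$ such that $B(\mu(x,y),z)=B(x,\mu(y,z))$ and $B(T(x),y)=B(x,T(y))$ for all $x,y,z$. When $T$ is in the centroid, $[x,y]=T(\mu(x,y))$ is a Lie bracket on $\mathfrak g$ and $B$ is invariant for it. Construction. Choose a subspace $\mathfrak a\subset\mathfrak g$ complementary to $\operatorname{Im}(T)$ (so $\dim\mathfrak a=r$), a basis $a_1,\dots,a_r$ of $\mathfrak a$ and a basis $v_1,\dots,v_r$ of $V$. Define $k:\mathfrak g\to\mathfrak G$ by $k(x)=T(x)+B(a_1,x)v_1+\cdots+B(a_r,x)v_r$, and $[x+u,y+v]_{\mathfrak G}=k(\mu(x,y))$ for $x,y\in\mathfrak g$, $u,v\in V$. Define the symmetric bilinear form $B_{\mathfrak G}$ on $\mathfrak G=\mathfrak a\oplus\operatorname{Im}(T)\oplus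 V$ by $B_{\mathfrak G}(T(x),T(y))=B(T(x),y)$; $B_{\mathfrak G}(\mathfrak a\oplus V,\operatorname{Im}(T))=B_{\mathfrak G}(\mathfrak a,\mathfrak a)=B_{\mathfrak G}(V,V)=\{0\}$; $B_{\mathfrak G}(a_i,v_j)=\delta_{ij}$. Then $(\mathfrak G,[\,\cdot\,,\,\cdot\,]_{\mathfrak G},B_{\mathfrak G})$ is a quadratic Lie algebra (a Lie algebra with a non-degenerate symmetric invariant bilinear form). Put $D_i=\mu(a_i,\,\cdot\,):\mathfrak g\to\mathfrak g$ and $\theta(x,y)=B(D_1(x),y)v_1+\cdots+B(D_r(x),y)v_r$ for $x,y\in\mathfrak g$; then $[x+u,y+v]_{\mathfrak G}=[x,y]+\theta(x,y)$, so $\theta$ is the $2$-cocycle defining $\mathfrak G$ as a central extension of $(\mathfrak g,[\,\cdot\,,\,\cdot\,])$ by $V$. Define $\mu_{\mathfrak G}(x+u,y+v)=\mu(x,y)$ and $L(x+u)=k(x)$ for $x,y\in\mathfrak g$, $u,v\in V$; then $(\mathfrak G,\mu_{\mathfrak G},L)$ is a Hom-Lie algebra. *)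

theory Defs
  imports "HOL-Analysis.Product_Vector" "HOL-Computational_Algebra.Polynomial"
begin

definition fin_dim_vector_space :: "('f::field \<Rightarrow> 'a::ab_group_add \<Rightarrow> 'a) \<Rightarrow> bool" where
  "fin_dim_vector_space s \<longleftrightarrow> (\<exists>Basis. finite_dimensional_vector_space s Basis)"

definition bilinear_map ::
  "('f::field \<Rightarrow> 'a::ab_group_add \<Rightarrow> 'a) \<Rightarrow> ('f \<Rightarrow> 'b::ab_group_add \<Rightarrow> 'b) \<Rightarrow>
   ('f \<Rightarrow> 'c::ab_group_add \<Rightarrow> 'c) \<Rightarrow> ('a \<Rightarrow> 'b \<Rightarrow> 'c) \<Rightarrow> bool" where
  "bilinear_map s1 s2 s3 f \<longleftrightarrow>
     (\<forall>x. Vector_Spaces.linear s2 s3 (f x)) \<and> (\<forall>y. Vector_Spaces.linear s1 s3 (\<lambda>x. f x y))"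

definition symmetric_form :: "('a \<Rightarrow> 'a \<Rightarrow> 'f) \<Rightarrow> bool" where
  "symmetric_form B \<longleftrightarrow> (\<forall>x y. B x y = B y x)"

definition nondegenerate_form :: "('a::zero \<Rightarrow> 'a \<Rightarrow> 'f::zero) \<Rightarrow> bool" where
  "nondegenerate_form B \<longleftrightarrow> (\<forall>x. (\<forall>y. B x y = 0) \<longrightarrow> x = 0)"

definition invariant_form :: "('a \<Rightarrow> 'a \<Rightarrow> 'a) \<Rightarrow> ('a \<Rightarrow> 'a \<Rightarrow> 'f) \<Rightarrow> bool" where
  "invariant_form mu B \<longleftrightarrow> (\<forall>x y z. B (mu x y) z = B x (mu y z))"

definition in_centroid :: "('a \<Rightarrow> 'a \<Rightarrow> 'a) \<Rightarrow> ('a \<Rightarrow> 'a) \<Rightarrow> bool" where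
  "in_centroid mu T \<longleftrightarrow> (\<forall>x y. T (mu x y) = mu (T x) y)"

definition hom_lie_algebra ::
  "('f::field \<Rightarrow> 'a::ab_group_add \<Rightarrow> 'a) \<Rightarrow> ('a \<Rightarrow> 'a \<Rightarrow> 'a) \<Rightarrow> ('a \<Rightarrow> 'a) \<Rightarrow> bool" where
  "hom_lie_algebra s mu T \<longleftrightarrow>
     fin_dim_vector_space s \<and>
     bilinear_map s s s mu \<and>
     (\<forall>x y. mu x y = - mu y x) \<and>
     Vector_Spaces.linear s s T \<and>
     (\<forall>x y z. mu (T x) (mu y z) + mu (T y) (mu z x) + mu (T z) (mu x y) = 0)"

definition quadratic_hom_lie_algebra ::
  "('f::field \<Rightarrow> 'a::ab_group_add \<Rightarrow> 'a) \<Rightarrow> ('a \<Rightarrow> 'a \<Rightarrow> 'a) \<Rightarrow> ('a \<Rightarrow> 'a) \<Rightarrow>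
   ('a \<Rightarrow> 'a \<Rightarrow> 'f) \<Rightarrow> bool" where
  "quadratic_hom_lie_algebra s mu T B \<longleftrightarrow>
     hom_lie_algebra s mu T \<and>
     bilinear_map s s (*) B \<and> symmetric_form B \<and> nondegenerate_form B \<and>
     invariant_form mu B \<and>
     (\<forall>x y. B (T x) y = B x (T y))"

definition complementary_subspaces ::
  "('f::field \<Rightarrow> 'a::ab_group_add \<Rightarrow> 'a) \<Rightarrow> 'a set \<Rightarrow> 'a set \<Rightarrow> bool" where
  "complementary_subspaces s A W \<longleftrightarrow>
     module.subspace s A \<and> module.subspace s W \<and>
     A \<inter> W = {0} \<and> (\<forall>x. \<exists>p\<in>A. \<exists>q\<in>W. x = p + q)"

definition basis_family ::
  "('f::field \<Rightarrow> 'a::ab_group_add \<Rightarrow> 'a) \<Rightarrow> nat \<Rightarrow> (nat \<Rightarrow> 'a) \<Rightarrow> 'a set \<Rightarrow> bool" where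
  "basis_family s r e W \<longleftrightarrow>
     inj_on e {1..r} \<and> \<not> module.dependent s (e ` {1..r}) \<and> module.span s (e ` {1..r}) = W"

text \<open>
  The direct sum of \<open>\<gg>\<close> and \<open>V\<close> is the product type, with \<open>x + u\<close> written \<open>(x, u)\<close> and scalar
  multiplication \<^const>\<open>module_prod.scale\<close>.
\<close>

definition k_map ::
  "('f::field \<Rightarrow> 'v::ab_group_add \<Rightarrow> 'v) \<Rightarrow> ('g \<Rightarrow> 'g) \<Rightarrow> ('g \<Rightarrow> 'g \<Rightarrow> 'f) \<Rightarrow>
   nat \<Rightarrow> (nat \<Rightarrow> 'g) \<Rightarrow> (nat \<Rightarrow> 'v) \<Rightarrow> 'g \<Rightarrow> 'g \<times> 'v" where
  "k_map sV T B r a v x = (T x, \<Sum>i=1..r. sV (B (a i) x) (v i))"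

definition theta ::
  "('f::field \<Rightarrow> 'v::ab_group_add \<Rightarrow> 'v) \<Rightarrow> ('g \<Rightarrow> 'g \<Rightarrow> 'g) \<Rightarrow> ('g \<Rightarrow> 'g \<Rightarrow> 'f) \<Rightarrow>
   nat \<Rightarrow> (nat \<Rightarrow> 'g) \<Rightarrow> (nat \<Rightarrow> 'v) \<Rightarrow> 'g \<Rightarrow> 'g \<Rightarrow> 'v" where
  "theta sV mu B r a v x y = (\<Sum>i=1..r. sV (B (mu (a i) x) y) (v i))"

definition mu_ext :: "('g \<Rightarrow> 'g \<Rightarrow> 'g) \<Rightarrow> 'g \<times> 'v::zero \<Rightarrow> 'g \<times> 'v \<Rightarrow> 'g \<times> 'v" where
  "mu_ext mu p q = (mu (fst p) (fst q), 0)"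

definition L_ext ::
  "('f::field \<Rightarrow> 'v::ab_group_add \<Rightarrow> 'v) \<Rightarrow> ('g \<Rightarrow> 'g) \<Rightarrow> ('g \<Rightarrow> 'g \<Rightarrow> 'f) \<Rightarrow>
   nat \<Rightarrow> (nat \<Rightarrow> 'g) \<Rightarrow> (nat \<Rightarrow> 'v) \<Rightarrow> 'g \<times> 'v \<Rightarrow> 'g \<times> 'v" where
  "L_ext sV T B r a v p = k_map sV T B r a v (fst p)"

definition is_B_ext ::
  "('f::field \<Rightarrow> 'g::ab_group_add \<Rightarrow> 'g) \<Rightarrow> ('f \<Rightarrow> 'v::ab_group_add \<Rightarrow> 'v) \<Rightarrow>
   ('g \<Rightarrow> 'g) \<Rightarrow> ('g \<Rightarrow> 'g \<Rightarrow> 'f) \<Rightarrow> 'g set \<Rightarrow> nat \<Rightarrow> (nat \<Rightarrow> 'g) \<Rightarrow> (nat \<Rightarrow> 'v) \<Rightarrow>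
   ('g \<times> 'v \<Rightarrow> 'g \<times> 'v \<Rightarrow> 'f) \<Rightarrow> bool" where
  "is_B_ext sg sV T B A r a v b \<longleftrightarrow>
     bilinear_map (module_prod.scale sg sV) (module_prod.scale sg sV) (*) b \<and>
     symmetric_form b \<and>
     (\<forall>x y. b (T x, 0) (T y, 0) = B (T x) y) \<and>
     (\<forall>x\<in>A. \<forall>u y. b (x, u) (T y, 0) = 0) \<and>
     (\<forall>x\<in>A. \<forall>y\<in>A. b (x, 0) (y, 0) = 0) \<and>
     (\<forall>u w. b (0, u) (0, w) = 0) \<and>
     (\<forall>i\<in>{1..r}. \<forall>j\<in>{1..r}. b (a i, 0) (0, v j) = (if i = j then 1 else 0))"

text \<open>The conditions determine the form uniquely: see \<open>is_B_ext_ex1\<close> below.\<close>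

definition B_ext ::
  "('f::field \<Rightarrow> 'g::ab_group_add \<Rightarrow> 'g) \<Rightarrow> ('f \<Rightarrow> 'v::ab_group_add \<Rightarrow> 'v) \<Rightarrow>
   ('g \<Rightarrow> 'g) \<Rightarrow> ('g \<Rightarrow> 'g \<Rightarrow> 'f) \<Rightarrow> 'g set \<Rightarrow> nat \<Rightarrow> (nat \<Rightarrow> 'g) \<Rightarrow> (nat \<Rightarrow> 'v) \<Rightarrow>
   'g \<times> 'v \<Rightarrow> 'g \<times> 'v \<Rightarrow> 'f" where
  "B_ext sg sV T B A r a v = (THE b. is_B_ext sg sV T B A r a v b)"

lemma k_map_mu:
  assumes "invariant_form mu B"
  shows "k_map sV T B r a v (mu x y) = (T (mu x y), theta sV mu B r a v x y)"
  using assms by (simp add: k_map_def theta_def invariant_form_def)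

lemma vector_space_mult: "vector_space ((*) :: 'f::field \<Rightarrow> 'f \<Rightarrow> 'f)"
  by unfold_locales (auto simp: algebra_simps)

lemma linear_mapI:
  assumes "vector_space s1" "vector_space s2"
    and "\<And>x y. f (x + y) = f x + f y" "\<And>c x. f (s1 c x) = s2 c (f x)"
  shows "Vector_Spaces.linear s1 s2 f"
  using assms unfolding Vector_Spaces.linear_iff by blast

lemma dual_family:
  fixes s :: "'f::field \<Rightarrow> 'a::ab_group_add \<Rightarrow> 'a"
  assumes "vector_space s" and b: "basis_family s r e W"
  obtains f where "\<And>i. Vector_Spaces.linear s (*) (f i)"
    and "\<And>i j. i \<in> {1..r} \<Longrightarrow> j \<in> {1..r} \<Longrightarrow> f i (e j) = (if i = j then 1 else 0)"
proof -
  interpret vector_space_pair s "(*) :: 'f \<Rightarrow> 'f \<Rightarrow> 'f"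
    using assms vector_space_mult by (simp add: vector_space_pair_def)
  have "\<exists>g. Vector_Spaces.linear s (*) g \<and> (\<forall>x\<in>e ` {1..r}. g x = (if x = e i then 1 else 0))" for i
    by (rule linear_independent_extend) (use b in \<open>simp add: basis_family_def\<close>)
  then obtain f where f: "\<And>i. Vector_Spaces.linear s (*) (f i)"
    "\<And>i x. x \<in> e ` {1..r} \<Longrightarrow> f i x = (if x = e i then 1 else 0)"
    by metis
  show thesis
  proof (rule that[OF f(1)])
    fix i j assume ij: "i \<in> {1..r}" "j \<in> {1..r}"
    have "inj_on e {1..r}"
      using b by (simp add: basis_family_def)
    then have "e j = e i \<longleftrightarrow> i = j"
      using ij by (metis inj_on_eq_iff)
    then show "f i (e j) = (if i = j then 1 else 0)"
      using f(2)[OF imageI[OF ij(2)], of i] by simp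
  qed
qed

lemma is_B_ext_exists:
  fixes sg :: "'f::field \<Rightarrow> 'g::ab_group_add \<Rightarrow> 'g" and sV :: "'f \<Rightarrow> 'v::ab_group_add \<Rightarrow> 'v"
  assumes q: "quadratic_hom_lie_algebra sg mu T B"
    and V: "vector_space sV"
    and compl: "complementary_subspaces sg A (range T)"
    and a: "basis_family sg r a A"
    and v: "basis_family sV r v UNIV"
  shows "\<exists>b. is_B_ext sg sV T B A r a v b"
proof -
  have T: "Vector_Spaces.linear sg sg T" and bil: "bilinear_map sg sg (*) B"
    and symB: "\<And>x y. B x y = B y x" and BT: "\<And>x y. B (T x) y = B x (T y)"
    using q unfolding quadratic_hom_lie_algebra_def hom_lie_algebra_def symmetric_form_def
    by blast+
  interpret T: Vector_Spaces.linear sg sg T by (rule T)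
  interpret Br: Vector_Spaces.linear sg "(*)" "B x" for x
    using bil by (simp add: bilinear_map_def)
  interpret Bl: Vector_Spaces.linear sg "(*)" "\<lambda>x. B x y" for y
    using bil by (simp add: bilinear_map_def)
  interpret gv: vector_space_prod sg sV
    using V T.vs1.vector_space_axioms by (simp add: vector_space_prod_def vector_space_pair_def)
  interpret gg: vector_space_pair sg sg ..
  have subA: "T.vs1.subspace A" and subT: "T.vs1.subspace (range T)"
    and int: "A \<inter> range T = {0}" and dec: "\<And>x. \<exists>p\<in>A. \<exists>q. x = p + T q"
    using compl unfolding complementary_subspaces_def by (blast, blast, blast, blast)
  obtain P where P: "\<And>x. P x \<in> A" "\<And>x. \<exists>q. x = P x + T q"
    using dec by metis
  have Pu: "P x = p" if "p \<in> A" "x = p + T q" for x p q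
  proof -
    obtain q' where q': "x = P x + T q'" using P(2)[of x] by (rule exE)
    have "P x - p \<in> A" using subA P(1) that(1) by (rule T.vs1.subspace_diff)
    moreover have "P x - p = T (q - q')"
    proof -
      have "P x + T q' = p + T q" using q' that(2) by (rule subst)
      then show ?thesis by (simp add: T.diff algebra_simps)
    qed
    ultimately have "P x - p \<in> A \<inter> range T" by simp
    then show ?thesis unfolding int by simp
  qed
  have PA: "P x = x" if "x \<in> A" for x using Pu[of x x 0] that by simp
  have PT: "P (T x) = 0" for x using Pu[of 0 "T x" x] subA T.vs1.subspace_0 by simp
  have Plin: "Vector_Spaces.linear sg sg P"
  proof (rule linear_mapI[OF T.vs1.vector_space_axioms T.vs1.vector_space_axioms])
    fix x y
    obtain q where "x = P x + T q" using P(2)[of x] by (rule exE)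
    moreover obtain q' where "y = P y + T q'" using P(2)[of y] by (rule exE)
    ultimately have "x + y = (P x + T q) + (P y + T q')" by (rule arg_cong2[where f = "(+)"])
    also have "\<dots> = (P x + P y) + T (q + q')" by (simp add: T.add ac_simps)
    finally show "P (x + y) = P x + P y"
      by (rule Pu[rotated]) (use subA P(1) in \<open>simp add: T.vs1.subspace_add\<close>)
  next
    fix c x
    obtain q where "x = P x + T q" using P(2)[of x] by (rule exE)
    then have "sg c x = sg c (P x + T q)" by (rule arg_cong)
    also have "\<dots> = sg c (P x) + T (sg c q)" by (simp add: T.scale T.vs1.scale_right_distrib)
    finally show "P (sg c x) = sg c (P x)"
      by (rule Pu[rotated]) (use subA P(1) in \<open>simp add: T.vs1.subspace_scale\<close>)
  qed
  interpret P: Vector_Spaces.linear sg sg P by (rule Plin)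
  obtain C where C: "C \<subseteq> range T" "\<not> T.vs1.dependent C" "range T \<subseteq> T.vs1.span C"
    using T.vs1.maximal_independent_subset by metis
  obtain h where h: "\<And>c. c \<in> C \<Longrightarrow> T (h c) = c"
    using C(1) by (metis f_inv_into_f subsetD)
  obtain S where S: "Vector_Spaces.linear sg sg S" "\<And>c. c \<in> C \<Longrightarrow> S c = h c"
    using gg.linear_independent_extend[OF C(2), of h] by metis
  interpret S: Vector_Spaces.linear sg sg S by (rule S(1))
  have TS: "T (S (T x)) = T x" for x
  proof -
    have "(\<lambda>z. T (S z)) (T x) = (\<lambda>z. z) (T x)"
    proof (rule gg.linear_eq_on_span[where B=C])
      show "Vector_Spaces.linear sg sg (\<lambda>z. T (S z))"
        by (rule linear_mapI[OF T.vs1.vector_space_axioms T.vs1.vector_space_axioms]) (simp_all add: S.add T.add S.scale T.scale)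
      show "Vector_Spaces.linear sg sg (\<lambda>z. z)" by (rule T.vs1.linear_ident)
      show "T (S z) = z" if "z \<in> C" for z using that S(2) h by simp
      show "T x \<in> T.vs1.span C" using C(3) by auto
    qed
    then show ?thesis by simp
  qed
  obtain f where f: "\<And>i. Vector_Spaces.linear sg (*) (f i)"
    "\<And>i j. i \<in> {1..r} \<Longrightarrow> j \<in> {1..r} \<Longrightarrow> f i (a j) = (if i = j then 1 else 0)"
    using dual_family[OF T.vs1.vector_space_axioms a] by metis
  obtain g where g: "\<And>i. Vector_Spaces.linear sV (*) (g i)"
    "\<And>i j. i \<in> {1..r} \<Longrightarrow> j \<in> {1..r} \<Longrightarrow> g i (v j) = (if i = j then 1 else 0)"
    using dual_family[OF V v] by metis
  interpret f: Vector_Spaces.linear sg "(*)" "f i" for i by (rule f(1))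
  interpret g: Vector_Spaces.linear sV "(*)" "g i" for i by (rule g(1))
  define Q where "Q x = S (x - P x)" for x
  have Q_add: "Q (x + y) = Q x + Q y" for x y
    by (simp add: Q_def P.add S.add S.diff)
  have Q_scale: "Q (sg c x) = sg c (Q x)" for c x
    by (simp add: Q_def P.scale S.scale S.diff T.vs1.scale_right_diff_distrib)
  have QA: "Q x = 0" if "x \<in> A" for x using that by (simp add: Q_def PA)
  have QT: "T (Q (T x)) = T x" for x by (simp add: Q_def PT TS)
  have Q0: "Q 0 = 0" and P0: "P 0 = 0" by (simp_all add: Q_def)
  define b where "b p q = B (T (Q (fst p))) (Q (fst q)) +
      (\<Sum>i=1..r. f i (P (fst p)) * g i (snd q) + f i (P (fst q)) * g i (snd p))" for p q
  have symb: "b p q = b q p" for p q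
    using BT[of "Q (fst p)" "Q (fst q)"] symB[of "Q (fst p)" "T (Q (fst q))"]
    by (simp add: b_def add.commute)
  have rlin: "Vector_Spaces.linear gv.scale (*) (b p)" for p
  proof (rule linear_mapI[OF gv.p.vector_space_axioms vector_space_mult])
    show "b p (x + y) = b p x + b p y" for x y
      by (simp add: b_def Q_add P.add Br.add f.add g.add distrib_left distrib_right
          sum.distrib)
    show "b p (gv.scale c x) = c * b p x" for c x
      unfolding b_def gv.scale_def fst_conv snd_conv Q_scale P.scale Br.scale f.scale g.scale
        distrib_left sum_distrib_left
      by (simp only: mult.assoc mult.left_commute)
  qed
  have aA: "a i \<in> A" if "i \<in> {1..r}" for i
  proof -
    have "a i \<in> T.vs1.span (a ` {1..r})" using that by (intro T.vs1.span_base) simp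
    then show ?thesis using a by (simp add: basis_family_def)
  qed
  have "is_B_ext sg sV T B A r a v b"
    unfolding is_B_ext_def
  proof (intro conjI allI ballI)
    show "bilinear_map gv.scale gv.scale (*) b"
    proof -
      have "(\<lambda>p. b p q) = b q" for q using symb by (intro ext)
      then show ?thesis using rlin by (simp add: bilinear_map_def)
    qed
    show "symmetric_form b" using symb by (simp add: symmetric_form_def)
    show "b (T x, 0) (T y, 0) = B (T x) y" for x y
      by (simp add: b_def QT PT BT)
    show "b (x, u) (T y, 0) = 0" if "x \<in> A" for x u y
      using that by (simp add: b_def QA PT)
    show "b (x, 0) (y, 0) = 0" if "x \<in> A" "y \<in> A" for x y
      using that by (simp add: b_def QA)
    show "b (0, u) (0, w) = 0" for u w
      by (simp add: b_def Q0 P0)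
    show "b (a i, 0) (0, v j) = (if i = j then 1 else 0)" if ij: "i \<in> {1..r}" "j \<in> {1..r}" for i j
    proof -
      have "b (a i, 0) (0, v j) = (\<Sum>l=1..r. f l (a i) * g l (v j))"
        using ij by (simp add: b_def Q0 P0 QA PA aA)
      also have "\<dots> = (\<Sum>l=1..r. if l = i then (if i = j then 1 else 0) else 0)"
        by (rule sum.cong) (use ij f(2) g(2) in auto)
      also have "\<dots> = (if i = j then 1 else 0)" using ij by simp
      finally show ?thesis .
    qed
  qed
  then show ?thesis by blast
qed

lemma is_B_ext_unique:
  fixes sg :: "'f::field \<Rightarrow> 'g::ab_group_add \<Rightarrow> 'g" and sV :: "'f \<Rightarrow> 'v::ab_group_add \<Rightarrow> 'v"
  assumes G: "vector_space sg" and V: "vector_space sV"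
    and compl: "complementary_subspaces sg A (range T)"
    and a: "basis_family sg r a A"
    and v: "basis_family sV r v UNIV"
    and b: "is_B_ext sg sV T B A r a v b" and b': "is_B_ext sg sV T B A r a v b'"
  shows "b = b'"
proof -
  interpret gv: vector_space_prod sg sV
    using V G by (simp add: vector_space_prod_def vector_space_pair_def)
  interpret gf: vector_space_pair sg "(*) :: 'f \<Rightarrow> 'f \<Rightarrow> 'f"
    using G vector_space_mult by (simp add: vector_space_pair_def)
  interpret vf: vector_space_pair sV "(*) :: 'f \<Rightarrow> 'f \<Rightarrow> 'f"
    using V vector_space_mult by (simp add: vector_space_pair_def)
  have lin_right: "Vector_Spaces.linear gv.scale (*) (c p)"
    and lin_left: "Vector_Spaces.linear gv.scale (*) (\<lambda>p. c p q)"
    and sym: "c p q = c q p"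
    if "is_B_ext sg sV T B A r a v c" for c p q
    using that unfolding is_B_ext_def bilinear_map_def symmetric_form_def by blast+
  have lin1: "Vector_Spaces.linear sg (*) (\<lambda>p. c (p, 0) (0, w))"
    if c: "is_B_ext sg sV T B A r a v c" for c w
  proof -
    interpret l: Vector_Spaces.linear gv.scale "(*)" "\<lambda>z. c z z'" for z'
      by (rule lin_left[OF c])
    show ?thesis
    proof (rule linear_mapI[OF G vector_space_mult])
      show "c (x + y, 0) (0, w) = c (x, 0) (0, w) + c (y, 0) (0, w)" for x y
        using l.add[of "(x, 0)" "(y, 0)"] by simp
      show "c (sg k x, 0) (0, w) = k * c (x, 0) (0, w)" for k x
        using l.scale[of k "(x, 0)"] by (simp add: gv.scale_def)
    qed
  qed
  have lin2: "Vector_Spaces.linear sV (*) (\<lambda>w. c (p, 0) (0, w))"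
    if c: "is_B_ext sg sV T B A r a v c" for c p
  proof -
    interpret r: Vector_Spaces.linear gv.scale "(*)" "c z" for z
      by (rule lin_right[OF c])
    show ?thesis
    proof (rule linear_mapI[OF V vector_space_mult])
      show "c (p, 0) (0, x + y) = c (p, 0) (0, x) + c (p, 0) (0, y)" for x y
        using r.add[of "(p, 0)" "(0, x)" "(0, y)"] by simp
      show "c (p, 0) (0, sV k x) = k * c (p, 0) (0, x)" for k x
        using r.scale[of "(p, 0)" k "(0, x)"] by (simp add: gv.scale_def)
    qed
  qed
  have expand: "c (p + T x, u) (q + T y, w) = B (T x) y + c (p, 0) (0, w) + c (q, 0) (0, u)"
    if c: "is_B_ext sg sV T B A r a v c" and A: "p \<in> A" "q \<in> A" for c x y p q u w
  proof -
    interpret l: Vector_Spaces.linear gv.scale "(*)" "\<lambda>z. c z z'" for z'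
      by (rule lin_left[OF c])
    have e: "c (p + T x, u) z = c (T x, 0) z + c (p, 0) z + c (0, u) z" for x p u z
      using l.add[of "(T x, 0)" "(p, u)"] l.add[of "(p, 0)" "(0, u)"] by (simp add: add.commute)
    have cT: "\<And>x y. c (T x, 0) (T y, 0) = B (T x) y"
      and cAT: "\<And>x u y. x \<in> A \<Longrightarrow> c (x, u) (T y, 0) = 0"
      and cA: "\<And>x y. x \<in> A \<Longrightarrow> y \<in> A \<Longrightarrow> c (x, 0) (y, 0) = 0"
      and cV: "\<And>u w. c (0, u) (0, w) = 0"
      using c unfolding is_B_ext_def by blast+
    have "0 \<in> A" using compl gv.vs1.subspace_0 by (auto simp: complementary_subspaces_def)
    then have k: "c (T x, 0) (T y, 0) = B (T x) y" "c (T y, 0) (T x, 0) = B (T x) y"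
      "c (p, 0) (T y, 0) = 0" "c (0, u) (T y, 0) = 0" "c (q, 0) (T x, 0) = 0"
      "c (0, w) (T x, 0) = 0" "c (q, 0) (p, 0) = 0" "c (0, w) (0, u) = 0"
      using cT cAT cA cV A sym[OF c, of "(T y, 0)" "(T x, 0)"] by simp_all
    have "c (T x, 0) (q + T y, w) = B (T x) y"
      by (subst sym[OF c]) (simp add: e k)
    moreover have "c (p, 0) (q + T y, w) = c (p, 0) (0, w)"
      by (subst sym[OF c]) (simp add: e k sym[OF c, of "(T y, 0)"] sym[OF c, of "(0, w)"])
    moreover have "c (0, u) (q + T y, w) = c (q, 0) (0, u)"
      by (subst sym[OF c]) (simp add: e k sym[OF c, of "(T y, 0)"])
    ultimately show ?thesis by (simp add: e)
  qed
  have pair: "b (p, 0) (0, w) = b' (p, 0) (0, w)" if "p \<in> A" for p w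
  proof (rule gf.linear_eq_on_span[OF lin1[OF b] lin1[OF b'], where B="a ` {1..r}"])
    show "p \<in> gv.vs1.span (a ` {1..r})" using a that by (simp add: basis_family_def)
    have dual: "c (a i, 0) (0, v j) = (if i = j then 1 else 0)"
      if "is_B_ext sg sV T B A r a v c" "i \<in> {1..r}" "j \<in> {1..r}" for c i j
      using that unfolding is_B_ext_def by blast
    fix z assume "z \<in> a ` {1..r}"
    then obtain i where i: "i \<in> {1..r}" "z = a i" by blast
    show "b (z, 0) (0, w) = b' (z, 0) (0, w)"
    proof (rule vf.linear_eq_on_span[OF lin2[OF b] lin2[OF b'], where B="v ` {1..r}"])
      show "w \<in> gv.vs2.span (v ` {1..r})" using v by (simp add: basis_family_def)
      show "b (z, 0) (0, y) = b' (z, 0) (0, y)" if "y \<in> v ` {1..r}" for y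
        using that i dual[OF b] dual[OF b'] by auto
    qed
  qed
  show ?thesis
  proof (intro ext)
    fix m n :: "'g \<times> 'v"
    have dec: "\<exists>p\<in>A. \<exists>q. x = p + T q" for x
      using compl by (force simp: complementary_subspaces_def)
    obtain p x q y where "p \<in> A" "q \<in> A" "m = (p + T x, snd m)" "n = (q + T y, snd n)"
      using dec[of "fst m"] dec[of "fst n"] by (metis prod.collapse)
    then show "b m n = b' m n"
      using expand[OF b] expand[OF b'] pair by metis
  qed
qed

lemma is_B_ext_ex1:
  assumes "quadratic_hom_lie_algebra sg mu T B" and "vector_space sV"
    and "complementary_subspaces sg A (range T)"
    and "basis_family sg r a A" and "basis_family sV r v UNIV"
  shows "\<exists>!b. is_B_ext sg sV T B A r a v b"
proof -
  have "vector_space sg"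
    using assms(1) unfolding quadratic_hom_lie_algebra_def hom_lie_algebra_def
      fin_dim_vector_space_def finite_dimensional_vector_space_def by blast
  with assms show ?thesis
    using is_B_ext_exists is_B_ext_unique by metis
qed

lemma is_B_ext_B_ext:
  assumes "quadratic_hom_lie_algebra sg mu T B" and "vector_space sV"
    and "complementary_subspaces sg A (range T)"
    and "basis_family sg r a A" and "basis_family sV r v UNIV"
  shows "is_B_ext sg sV T B A r a v (B_ext sg sV T B A r a v)"
  unfolding B_ext_def by (rule theI'[OF is_B_ext_ex1[OF assms]])

end

theory Submission
  imports Defs
begin

text \<open>
  The \<open>V\<close>-component of \<open>L (\<mu>\<^sub>G (x, y))\<close> is \<open>\<theta> x y\<close>, while that of \<open>\<mu>\<^sub>G (L x, y)\<close> is zero; this is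
  part (ii). For part (i), the form \<open>B\<^sub>G\<close> vanishes on \<open>\<gg> \<times> \<aa>\<close>, and \<open>\<mu>\<^sub>G\<close> takes values in \<open>\<gg>\<close>. Hence
  \<open>B\<^sub>G (x + u, \<mu> y a\<^sub>i) = B\<^sub>G (\<mu> x y, a\<^sub>i) = 0\<close> for all \<open>x\<close> and \<open>u\<close>, so nondegeneracy of \<open>B\<^sub>G\<close> gives
  \<open>\<mu> y a\<^sub>i = 0\<close>, and therefore \<open>\<theta> = 0\<close>.
\<close>

text \<open>Nondegeneracy of \<open>b\<close> on the vectors of \<open>sg\<close>. Split
  \<open>x = p + T z\<close> with \<open>p\<close> in \<open>A\<close>: pairing with
  \<open>range T\<close> detects only \<open>T z\<close>, through the nondegeneracy of
  \<open>B\<close>, and pairing with the \<open>v j\<close> reads off the coordinates of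
  \<open>p\<close> in the basis \<open>a\<close>.\<close>

lemma is_B_ext_orthogonal_eq_0:
  fixes sg :: "'f::field \<Rightarrow> 'g::ab_group_add \<Rightarrow> 'g" and sV :: "'f \<Rightarrow> 'v::ab_group_add \<Rightarrow> 'v"
  assumes q: "quadratic_hom_lie_algebra sg mu T B"
    and V: "vector_space sV"
    and compl: "complementary_subspaces sg A (range T)"
    and a: "basis_family sg r a A"
    and b: "is_B_ext sg sV T B A r a v b"
    and orthT: "\<And>y. b (x, 0) (T y, 0) = 0"
    and orthV: "\<And>w. b (x, 0) (0, w) = 0"
  shows "x = 0"
proof -
  have T: "Vector_Spaces.linear sg sg T"
    and nd: "\<And>x. (\<And>y. B x y = 0) \<Longrightarrow> x = 0"
    using q unfolding quadratic_hom_lie_algebra_def hom_lie_algebra_def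
      nondegenerate_form_def by blast+
  interpret T: Vector_Spaces.linear sg sg T by (rule T)
  interpret gv: vector_space_prod sg sV
    using V T.vs1.vector_space_axioms by (simp add: vector_space_prod_def vector_space_pair_def)
  interpret l: Vector_Spaces.linear gv.scale "(*)" "\<lambda>z. b z z'" for z'
    using b unfolding is_B_ext_def bilinear_map_def by blast
  have bT: "\<And>x y. b (T x, 0) (T y, 0) = B (T x) y"
    and bAT: "\<And>x u y. x \<in> A \<Longrightarrow> b (x, u) (T y, 0) = 0"
    and dual: "\<And>i j. i \<in> {1..r} \<Longrightarrow> j \<in> {1..r} \<Longrightarrow>
      b (a i, 0) (0, v j) = (if i = j then 1 else 0)"
    using b unfolding is_B_ext_def by blast+
  obtain p z where p: "p \<in> A" and x: "x = p + T z"
    using compl unfolding complementary_subspaces_def by blast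
  have split: "b (x, 0) m = b (p, 0) m + b (T z, 0) m" for m
    using l.add[of "(p, 0)" "(T z, 0)"] by (simp add: x)
  \<comment> \<open>The summand \<open>p\<close> drops out, because \<open>A\<close> is orthogonal
    to \<open>range T\<close>.\<close>
  have "B (T z) y = 0" for y
    using orthT[of y] split[of "(T y, 0)"] by (simp add: bT bAT[OF p])
  then have Tz: "T z = 0" by (rule nd)
  have "p \<in> T.vs1.span (a ` {1..r})" using p a by (simp add: basis_family_def)
  then obtain u where "p = (\<Sum>e\<in>a ` {1..r}. sg (u e) e)"
    by (auto simp: T.vs1.span_finite)
  then have pu: "p = (\<Sum>i=1..r. sg (u (a i)) (a i))"
    using a by (simp add: basis_family_def sum.reindex)
  \<comment> \<open>Since \<open>T z = 0\<close>, \<open>x\<close> is \<open>p\<close>, and by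
    duality of the two bases pairing with \<open>v j\<close> extracts its \<open>j\<close>-th
    coordinate.\<close>
  have "u (a j) = 0" if j: "j \<in> {1..r}" for j
  proof -
    have "(p, 0) = (\<Sum>i=1..r. gv.scale (u (a i)) (a i, 0))"
      by (simp add: pu gv.scale_def sum_prod)
    then have "b (p, 0) (0, v j) = (\<Sum>i=1..r. u (a i) * b (a i, 0) (0, v j))"
      by (simp only: l.sum l.scale)
    also have "\<dots> = (\<Sum>i=1..r. if i = j then u (a j) else 0)"
      by (rule sum.cong) (use j dual in auto)
    also have "\<dots> = u (a j)" using j by simp
    finally show ?thesis using orthV[of "v j"] by (simp add: x Tz)
  qed
  then have "p = 0" by (simp add: pu)
  then show ?thesis by (simp add: x Tz)
qed

text \<open>Applied to the \<open>a i\<close>, this kills the operators \<open>mu (a i)\<close> from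
  which \<open>theta\<close> is built.\<close>

lemma invariant_B_ext_imp_mu_eq_0:
  fixes sg :: "'f::field \<Rightarrow> 'g::ab_group_add \<Rightarrow> 'g" and sV :: "'f \<Rightarrow> 'v::ab_group_add \<Rightarrow> 'v"
  assumes q: "quadratic_hom_lie_algebra sg mu T B"
    and V: "vector_space sV"
    and compl: "complementary_subspaces sg A (range T)"
    and a: "basis_family sg r a A"
    and b: "is_B_ext sg sV T B A r a v b"
    and inv: "invariant_form (mu_ext mu) b"
    and c: "c \<in> A"
  shows "mu c y = 0"
proof -
  have T: "Vector_Spaces.linear sg sg T"
    and skew: "\<And>x y. mu x y = - mu y x"
    using q unfolding quadratic_hom_lie_algebra_def hom_lie_algebra_def by blast+
  interpret T: Vector_Spaces.linear sg sg T by (rule T)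
  interpret gv: vector_space_prod sg sV
    using V T.vs1.vector_space_axioms by (simp add: vector_space_prod_def vector_space_pair_def)
  interpret l: Vector_Spaces.linear gv.scale "(*)" "\<lambda>z. b z z'" for z'
    using b unfolding is_B_ext_def bilinear_map_def by blast
  have bAT: "\<And>x u y. x \<in> A \<Longrightarrow> b (x, u) (T y, 0) = 0"
    and bA: "\<And>x y. x \<in> A \<Longrightarrow> y \<in> A \<Longrightarrow> b (x, 0) (y, 0) = 0"
    and sym: "\<And>p q. b p q = b q p"
    using b unfolding is_B_ext_def symmetric_form_def by blast+
  \<comment> \<open>The component \<open>u\<close> is arbitrary because \<open>mu_ext\<close>
    discards it; this freedom later yields orthogonality to \<open>V\<close> as well.\<close>
  have inv': "b (mu x y, 0) (z, w) = b (x, u) (mu y z, 0)" for x y z u w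
    using inv[unfolded invariant_form_def, rule_format, of "(x, u)" "(y, 0)" "(z, w)"]
    by (simp add: mu_ext_def)
  have orthA: "b (x, 0) (c, 0) = 0" for x
  proof -
    obtain p z where p: "p \<in> A" and x: "x = p + T z"
      using compl unfolding complementary_subspaces_def by blast
    have "b (x, 0) (c, 0) = b (p, 0) (c, 0) + b (T z, 0) (c, 0)"
      using l.add[of "(p, 0)" "(T z, 0)"] by (simp add: x)
    then show ?thesis using bA[OF p c] bAT[OF c] sym by simp
  qed
  \<comment> \<open>Invariance trades this pairing for that of \<open>mu x y\<close> with
    \<open>c\<close>, which \<open>orthA\<close> annihilates.\<close>
  have orth: "b (mu y c, 0) (x, u) = 0" for x u
    using inv'[of x y c 0 u] orthA sym by metis
  have "mu y c = 0"
    by (rule is_B_ext_orthogonal_eq_0[OF q V compl a b]) (rule orth)+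
  then show ?thesis using skew[of c y] by simp
qed

text \<open>The first components of both sides agree because \<open>T\<close> lies in the centroid
  of \<open>mu\<close>, so only the second components matter; invariance of \<open>B\<close> turns
  the one on the left into \<open>theta\<close>, by \<open>k_map_mu\<close>.\<close>

lemma in_centroid_L_ext_iff:
  assumes "invariant_form mu B" and "in_centroid mu T"
  shows "in_centroid (mu_ext mu) (L_ext sV T B r a v) \<longleftrightarrow>
    (\<forall>x y. theta sV mu B r a v x y = 0)"
  using assms(2) k_map_mu[OF assms(1), of sV T r a v]
  by (auto simp: in_centroid_def L_ext_def mu_ext_def k_map_def)

theorem corollary1p6:
  fixes sg :: "'f::{alg_closed_field, field_char_0} \<Rightarrow> 'g::ab_group_add \<Rightarrow> 'g"
    and sV :: "'f \<Rightarrow> 'v::ab_group_add \<Rightarrow> 'v"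
    and mu :: "'g \<Rightarrow> 'g \<Rightarrow> 'g" and T :: "'g \<Rightarrow> 'g" and B :: "'g \<Rightarrow> 'g \<Rightarrow> 'f"
    and A :: "'g set" and r :: nat and a :: "nat \<Rightarrow> 'g" and v :: "nat \<Rightarrow> 'v"
  assumes "quadratic_hom_lie_algebra sg mu T B"
    and "in_centroid mu T"
    and "vector_space.dim sg {x. T x = 0} = r" and "r > 0"
    and "vector_space sV"
    and "complementary_subspaces sg A (range T)"
    and "basis_family sg r a A"
    and "basis_family sV r v UNIV"
  shows
    "(invariant_form (mu_ext mu) (B_ext sg sV T B A r a v) \<longrightarrow>
        (\<forall>x y. theta sV mu B r a v x y = 0)) \<and>
     (in_centroid (mu_ext mu) (L_ext sV T B r a v) \<longleftrightarrow>
        (\<forall>x y. theta sV mu B r a v x y = 0))"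
proof (intro conjI impI allI)
  note q = assms(1) and V = assms(5) and compl = assms(6) and a = assms(7)
  let ?b = "B_ext sg sV T B A r a v"
  have b: "is_B_ext sg sV T B A r a v ?b"
    by (rule is_B_ext_B_ext[OF q V compl a assms(8)])
  interpret V: vector_space sV by (rule V)
  have bil: "bilinear_map sg sg (*) B"
    and G: "vector_space sg"
    using q unfolding quadratic_hom_lie_algebra_def hom_lie_algebra_def
      fin_dim_vector_space_def finite_dimensional_vector_space_def by blast+
  interpret G: vector_space sg by (rule G)
  interpret Bl: Vector_Spaces.linear sg "(*)" "\<lambda>x. B x y" for y
    using bil by (simp add: bilinear_map_def)
  fix x y
  assume inv_ext: "invariant_form (mu_ext mu) ?b"
  have "mu (a i) x = 0" if "i \<in> {1..r}" for i
  proof (rule invariant_B_ext_imp_mu_eq_0[OF q V compl a b inv_ext])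
    have "a i \<in> G.span (a ` {1..r})" using that by (intro G.span_base) simp
    then show "a i \<in> A" using a by (simp add: basis_family_def)
  qed
  then show "theta sV mu B r a v x y = 0"
    by (simp add: theta_def)
next
  show "in_centroid (mu_ext mu) (L_ext sV T B r a v) \<longleftrightarrow>
      (\<forall>x y. theta sV mu B r a v x y = 0)"
    using assms(1,2) by (intro in_centroid_L_ext_iff) (simp_all add: quadratic_hom_lie_algebra_def)
qed

end
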